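(* Let $d\ge 2$ be an integer and let $(p_j)_{j\ge1}$ be a sequence in $(0,1]$ with $p_j<1$ for infinitely many $j$. The (irreducible) $\mathrm{AMFC}_d$ Markov chain on $\mathbb{Z}_+=\{0,1,2,\dots\}$ associated to $(p_j)_{j\ge 1}$ is null recurrent if and only if $\prod_{j=1}^{+\infty}p_j=0$. Otherwise the chain is transient.
   Context: For $n\in\mathbb{Z}_+$ write its $d$-adic expansion $n=\sum_{j\ge1}a_j(n)d^{j-1}$ with digits $a_j(n)\in\{0,\dots,d-1\}$, and let $\zeta_n=\min\{j\ge1: a_j(n)\ne d-1\}$. The $\mathrm{AMFC}_d$ Markov chain (adding machine with fallible counter) associated to $(p_j)_{j\ge1}$ is the time-homogeneous Markov chain on $\mathbb{Z}_+$ with transition probabilities $s(n,m)=P(X(t+1)=m\mid X(t)=n)$ given by: $s(n,n+1)=\prod_{j=1}^{\zeta_n}p_j$; $s(n,n)=1-p_1$; if $\zeta_n\ge2$, $s\big(n,\,n-\sum_{j=1}^r(d-1)d^{j-1}\big)=(1-p_{r+1})\prod_{j=1}^r p_j$ for $1\le r\le\zeta_n-1$; and $s(n,m)=0$ otherwise. The chain is irreducible if and only if $p_j<1$ for infinitely many $j$, which is assumed. *)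

theory Defs
  imports "HOL-Probability.Probability"
begin

section \<open>Markov chains on a discrete state space\<close>

text \<open>
  Time-homogeneous Markov chain with transition probabilities \<open>s\<close>: conditionally on any history
  of positive probability, the next state is distributed according to the current row of \<open>s\<close>.
  The positivity guard is needed because \<open>cond_prob\<close> is 0 when the conditioning event is null.
\<close>

definition markov_chain ::
  "('s \<Rightarrow> 's \<Rightarrow> real) \<Rightarrow> 'a measure \<Rightarrow> (nat \<Rightarrow> 'a \<Rightarrow> 's) \<Rightarrow> bool" where
  "markov_chain s M X \<longleftrightarrow>
     prob_space M \<and>
     (\<forall>t. X t \<in> measurable M (count_space UNIV)) \<and>
     (\<forall>t x y. \<P>(\<omega> in M. \<forall>i\<le>t. X i \<omega> = x i) > 0 \<longrightarrow>
        \<P>(\<omega> in M. X (Suc t) \<omega> = y \<bar> \<forall>i\<le>t. X i \<omega> = x i) = s (x t) y)"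

text \<open>
  Recurrence and transience of a state \<open>x\<close> concern the chain started at \<open>x\<close>. As usual, the chain
  is therefore given by one process \<open>X\<close> and a family of laws, \<open>P x\<close> being the law under which
  \<open>X\<close> starts at \<open>x\<close>.
\<close>

definition markov_family ::
  "('s \<Rightarrow> 's \<Rightarrow> real) \<Rightarrow> ('s \<Rightarrow> 'a measure) \<Rightarrow> (nat \<Rightarrow> 'a \<Rightarrow> 's) \<Rightarrow> bool" where
  "markov_family s P X \<longleftrightarrow>
     (\<forall>x. markov_chain s (P x) X \<and> \<P>(\<omega> in P x. X 0 \<omega> = x) = 1)"

text \<open>The value is \<open>\<infinity>\<close>, the infimum of the empty set, on paths that never return to \<open>x\<close>.\<close>

definition return_time :: "(nat \<Rightarrow> 'a \<Rightarrow> 's) \<Rightarrow> 's \<Rightarrow> 'a \<Rightarrow> enat" where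
  "return_time X x \<omega> = (INF t\<in>{t. 1 \<le> t \<and> X t \<omega> = x}. enat t)"

definition recurrent_state :: "('s \<Rightarrow> 'a measure) \<Rightarrow> (nat \<Rightarrow> 'a \<Rightarrow> 's) \<Rightarrow> 's \<Rightarrow> bool" where
  "recurrent_state P X x \<longleftrightarrow> \<P>(\<omega> in P x. return_time X x \<omega> < \<infinity>) = 1"

definition transient_state :: "('s \<Rightarrow> 'a measure) \<Rightarrow> (nat \<Rightarrow> 'a \<Rightarrow> 's) \<Rightarrow> 's \<Rightarrow> bool" where
  "transient_state P X x \<longleftrightarrow> \<P>(\<omega> in P x. return_time X x \<omega> < \<infinity>) < 1"

definition null_recurrent_state :: "('s \<Rightarrow> 'a measure) \<Rightarrow> (nat \<Rightarrow> 'a \<Rightarrow> 's) \<Rightarrow> 's \<Rightarrow> bool" where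
  "null_recurrent_state P X x \<longleftrightarrow>
     recurrent_state P X x \<and> (\<integral>\<^sup>+\<omega>. ennreal_of_enat (return_time X x \<omega>) \<partial>P x) = \<infinity>"

definition null_recurrent :: "('s \<Rightarrow> 'a measure) \<Rightarrow> (nat \<Rightarrow> 'a \<Rightarrow> 's) \<Rightarrow> bool" where
  "null_recurrent P X \<longleftrightarrow> (\<forall>x. null_recurrent_state P X x)"

definition transient :: "('s \<Rightarrow> 'a measure) \<Rightarrow> (nat \<Rightarrow> 'a \<Rightarrow> 's) \<Rightarrow> bool" where
  "transient P X \<longleftrightarrow> (\<forall>x. transient_state P X x)"


section \<open>The adding machine with fallible counter\<close>

text \<open>Digits are indexed from \<open>j = 1\<close>, the coefficient of \<open>d ^ 0\<close>.\<close>

definition digit :: "nat \<Rightarrow> nat \<Rightarrow> nat \<Rightarrow> nat" where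
  "digit d n j = n div d ^ (j - 1) mod d"

lemma digit_less: "d \<ge> 2 \<Longrightarrow> digit d n j < d"
  by (simp add: digit_def)

lemma digit_expansion_mod: "(\<Sum>j=1..k. digit d n j * d ^ (j - 1)) = n mod d ^ k"
proof (induction k)
  case (Suc k)
  have "n mod d ^ Suc k = d ^ k * (n div d ^ k mod d) + n mod d ^ k"
    by (metis mod_mult2_eq power_Suc2)
  with Suc show ?case by (simp add: digit_def)
qed simp

lemma digit_expansion:
  assumes "d \<ge> 2" "n < d ^ k"
  shows "n = (\<Sum>j=1..k. digit d n j * d ^ (j - 1))"
  using assms by (simp only: digit_expansion_mod mod_less)

definition zeta :: "nat \<Rightarrow> nat \<Rightarrow> nat" where
  "zeta d n = (LEAST j. 1 \<le> j \<and> digit d n j \<noteq> d - 1)"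

text \<open>
  In the last case, a target \<open>m\<close> is reached by resetting the \<open>r\<close> lowest digits, all of them equal
  to \<open>d - 1\<close>, when \<open>m = n - (\<Sum>j=1..r. (d - 1) * d ^ (j - 1))\<close>. This is stated additively to avoid
  truncated subtraction. For \<open>d \<ge> 2\<close> at most one \<open>r\<close> satisfies it, so that the sum has at most one
  term, and it is 0 if there is none. The values \<open>p j\<close> are used for \<open>j \<ge> 1\<close> only.
\<close>

definition amfc :: "nat \<Rightarrow> (nat \<Rightarrow> real) \<Rightarrow> nat \<Rightarrow> nat \<Rightarrow> real" where
  "amfc d p n m =
     (if m = n + 1 then \<Prod>j=1..zeta d n. p j
      else if m = n then 1 - p 1
      else \<Sum>r | 1 \<le> r \<and> r \<le> zeta d n - 1 \<and> m + (\<Sum>j=1..r. (d - 1) * d ^ (j - 1)) = n.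
             (1 - p (r + 1)) * (\<Prod>j=1..r. p j))"

end

theory Submission
  imports Defs "HOL-Library.Log_Nat"
begin

text \<open>
  Write \<open>q n x\<close> for the probability that the chain started at \<open>x\<close> avoids \<open>y\<close> at times \<open>1, \<dots>, n\<close>.
  It satisfies \<open>q (n + 1) x = (\<Sum>z \<noteq> y. s x z * q n z)\<close>, and \<open>y\<close> is recurrent iff \<open>q n y\<close> tends to 0,
  null iff moreover \<open>\<Sum>n. q n y\<close> diverges. The chain climbs by steps of 1, and a failure at \<open>d ^ k - 1\<close>
  in counter \<open>k + 1\<close> leads to 0. Hence the chance to climb from \<open>d ^ (k - 1)\<close> to \<open>d ^ k\<close> before
  falling to 0 is \<open>p (k + 1)\<close>, and the chain escapes iff the infinite product is positive. Null
  recurrence comes from the counting measure, which up to a boundary term is invariant on every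
  \<open>{..<d ^ K}\<close> and has infinite mass.
\<close>

section \<open>Avoidance probabilities of Markov chains\<close>

text \<open>\<open>F x\<close> is meant as a finite set carrying row \<open>x\<close>, so that one
  step is a finite sum. The start \<open>x\<close> is not tested against \<open>y\<close>, so that
  \<open>x = y\<close> describes a return.\<close>

primrec avoid :: "('s \<Rightarrow> 's \<Rightarrow> real) \<Rightarrow> ('s \<Rightarrow> 's set) \<Rightarrow> 's \<Rightarrow> nat \<Rightarrow> 's \<Rightarrow> real" where
  "avoid s F y 0 x = 1"
| "avoid s F y (Suc n) x = (\<Sum>z\<in>F x - {y}. s x z * avoid s F y n z)"

text \<open>Product form of the Markov property; on a null history both sides vanish.\<close>

lemma markov_chain_history_Suc:
  assumes "markov_chain s M X"
  shows "\<P>(\<omega> in M. (\<forall>i\<le>t. X i \<omega> = x i) \<and> X (Suc t) \<omega> = z) =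
    \<P>(\<omega> in M. \<forall>i\<le>t. X i \<omega> = x i) * s (x t) z"
proof -
  interpret prob_space M using assms by (simp add: markov_chain_def)
  have [measurable]: "X t \<in> measurable M (count_space UNIV)" for t
    using assms by (simp add: markov_chain_def)
  let ?H = "\<P>(\<omega> in M. \<forall>i\<le>t. X i \<omega> = x i)"
  show ?thesis
  proof (cases "?H > 0")
    case True
    then have "\<P>(\<omega> in M. X (Suc t) \<omega> = z \<bar> \<forall>i\<le>t. X i \<omega> = x i) = s (x t) z"
      using assms by (simp add: markov_chain_def)
    with True show ?thesis by (simp add: cond_prob_def field_simps conj_commute)
  next
    case False
    then have H: "?H = 0" by (simp add: zero_less_measure_iff)
    have "\<P>(\<omega> in M. (\<forall>i\<le>t. X i \<omega> = x i) \<and> X (Suc t) \<omega> = z) \<le> ?H"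
      by (rule finite_measure_mono) auto
    with H show ?thesis by (simp add: measure_le_0_iff)
  qed
qed

text \<open>Induction on \<open>n\<close> absorbs the next state \<open>z\<close> into the history
  as \<open>x(Suc t := z)\<close>, hence the arbitrary \<open>t\<close> and
  \<open>x\<close>.\<close>

lemma markov_chain_avoid:
  assumes mc: "markov_chain s M X"
    and fin: "\<And>x. finite (F x)" and stoch: "\<And>x. (\<Sum>z\<in>F x. s x z) = 1"
  shows "\<P>(\<omega> in M. (\<forall>i\<le>t. X i \<omega> = x i) \<and> (\<forall>i\<in>{t<..t+n}. X i \<omega> \<noteq> y)) =
    \<P>(\<omega> in M. \<forall>i\<le>t. X i \<omega> = x i) * avoid s F y n (x t)"
proof (induction n arbitrary: t x)
  case 0
  then show ?case by simp
next
  case (Suc n)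
  interpret prob_space M using mc by (simp add: markov_chain_def)
  have [measurable]: "X t \<in> measurable M (count_space UNIV)" for t
    using mc by (simp add: markov_chain_def)
  have [measurable]: "Measurable.pred M (\<lambda>\<omega>. X t \<omega> \<in> A)" for t A
    by (rule measurable_compose[of "X t" M "count_space UNIV"]) simp_all
  let ?h = "\<lambda>\<omega>. \<forall>i\<le>t. X i \<omega> = x i"
  let ?H = "\<P>(\<omega> in M. ?h \<omega>)"
  define E where "E z = {\<omega>\<in>space M. (\<forall>i\<le>Suc t. X i \<omega> = (x(Suc t := z)) i) \<and>
    (\<forall>i\<in>{Suc t<..Suc t+n}. X i \<omega> \<noteq> y)}" for z
  have h_upd: "(\<forall>i\<le>Suc t. X i \<omega> = (x(Suc t := z)) i) \<longleftrightarrow> ?h \<omega> \<and> X (Suc t) \<omega> = z" for z \<omega>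
    by (auto simp: le_Suc_eq)
  have meas: "E z \<in> events" for z unfolding E_def by measurable
  have step: "\<P>(\<omega> in M. ?h \<omega> \<and> X (Suc t) \<omega> \<in> A) = ?H * (\<Sum>z\<in>A. s (x t) z)"
    if "finite A" for A
  proof -
    have "{\<omega>\<in>space M. ?h \<omega> \<and> X (Suc t) \<omega> \<in> A} = (\<Union>z\<in>A. {\<omega>\<in>space M. ?h \<omega> \<and> X (Suc t) \<omega> = z})"
      by auto
    then have "\<P>(\<omega> in M. ?h \<omega> \<and> X (Suc t) \<omega> \<in> A) =
        (\<Sum>z\<in>A. \<P>(\<omega> in M. ?h \<omega> \<and> X (Suc t) \<omega> = z))"
      using that by (simp only:) (rule finite_measure_finite_Union, auto simp: disjoint_family_on_def)
    then show ?thesis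
      by (simp add: markov_chain_history_Suc[OF mc] sum_distrib_left)
  qed
  \<comment> \<open>The row sums to 1 over \<open>F (x t)\<close>, so after this history the chain
    almost surely moves into \<open>F (x t)\<close>. Up to a null set the avoidance event is then a
    finite disjoint union of sets \<open>E z\<close>.\<close>
  have "{\<omega>\<in>space M. ?h \<omega>} = {\<omega>\<in>space M. ?h \<omega> \<and> X (Suc t) \<omega> \<in> F (x t)} \<union>
      {\<omega>\<in>space M. ?h \<omega> \<and> X (Suc t) \<omega> \<notin> F (x t)}"
    by blast
  moreover have "prob \<dots> = \<P>(\<omega> in M. ?h \<omega> \<and> X (Suc t) \<omega> \<in> F (x t)) +
      \<P>(\<omega> in M. ?h \<omega> \<and> X (Suc t) \<omega> \<notin> F (x t))"
    by (rule finite_measure_Union) (measurable, measurable, simp add: disjoint_iff)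
  ultimately have "?H = \<P>(\<omega> in M. ?h \<omega> \<and> X (Suc t) \<omega> \<in> F (x t)) +
      \<P>(\<omega> in M. ?h \<omega> \<and> X (Suc t) \<omega> \<notin> F (x t))"
    by (simp only:)
  then have "\<P>(\<omega> in M. ?h \<omega> \<and> X (Suc t) \<omega> \<notin> F (x t)) = 0"
    using step[OF fin, of "x t"] stoch by simp
  then have ae: "AE \<omega> in M. \<not> (?h \<omega> \<and> X (Suc t) \<omega> \<notin> F (x t))"
    by (subst (asm) prob_eq_0) auto
  have "\<P>(\<omega> in M. ?h \<omega> \<and> (\<forall>i\<in>{t<..t+Suc n}. X i \<omega> \<noteq> y)) = prob (\<Union>z\<in>F (x t) - {y}. E z)"
  proof (rule finite_measure_eq_AE)
    have split: "{t<..t+Suc n} = insert (Suc t) {Suc t<..Suc t+n}" by auto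
    show "AE \<omega> in M. \<omega> \<in> {\<omega>\<in>space M. ?h \<omega> \<and> (\<forall>i\<in>{t<..t+Suc n}. X i \<omega> \<noteq> y)} \<longleftrightarrow>
        \<omega> \<in> (\<Union>z\<in>F (x t) - {y}. E z)"
      using ae by eventually_elim (simp only: split E_def h_upd, auto)
    show "{\<omega>\<in>space M. ?h \<omega> \<and> (\<forall>i\<in>{t<..t+Suc n}. X i \<omega> \<noteq> y)} \<in> events" by measurable
    show "(\<Union>z\<in>F (x t) - {y}. E z) \<in> events" using meas fin by auto
  qed
  also have "\<dots> = (\<Sum>z\<in>F (x t) - {y}. prob (E z))"
    using fin meas
    by (intro finite_measure_finite_Union) (auto simp: disjoint_family_on_def E_def h_upd)
  also have "\<dots> = (\<Sum>z\<in>F (x t) - {y}. ?H * s (x t) z * avoid s F y n z)"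
    unfolding E_def Suc.IH unfolding h_upd markov_chain_history_Suc[OF mc] by simp
  finally show ?case by (simp add: sum_distrib_left mult.assoc)
qed

section \<open>Law and mean of the return time\<close>

lemma less_return_time_iff:
  "enat n < return_time X x \<omega> \<longleftrightarrow> (\<forall>i\<in>{0<..n}. X i \<omega> \<noteq> x)"
proof
  assume lt: "enat n < return_time X x \<omega>"
  show "\<forall>i\<in>{0<..n}. X i \<omega> \<noteq> x"
  proof (intro ballI notI)
    fix i assume "i \<in> {0<..n}" "X i \<omega> = x"
    then have "return_time X x \<omega> \<le> enat i"
      unfolding return_time_def by (intro INF_lower) auto
    also have "\<dots> \<le> enat n" using \<open>i \<in> {0<..n}\<close> by simp
    finally show False using lt by simp
  qed
next
  assume *: "\<forall>i\<in>{0<..n}. X i \<omega> \<noteq> x"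
  have "enat (Suc n) \<le> return_time X x \<omega>"
    unfolding return_time_def
  proof (rule INF_greatest)
    fix t assume "t \<in> {t. 1 \<le> t \<and> X t \<omega> = x}"
    then have "\<not> t \<le> n" using * by auto
    then show "enat (Suc n) \<le> enat t" by simp
  qed
  then show "enat n < return_time X x \<omega>"
    using less_le_trans[of "enat n" "enat (Suc n)"] by simp
qed

locale finite_row_chain =
  fixes s :: "'s \<Rightarrow> 's \<Rightarrow> real" and P :: "'s \<Rightarrow> 'a measure" and X :: "nat \<Rightarrow> 'a \<Rightarrow> 's"
    and F :: "'s \<Rightarrow> 's set"
  assumes family: "markov_family s P X"
    and fin: "\<And>x. finite (F x)" and stoch: "\<And>x. (\<Sum>z\<in>F x. s x z) = 1"
begin

lemma chain: "markov_chain s (P x) X"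
  using family by (simp add: markov_family_def)

lemma prob_space_chain: "prob_space (P x)"
  using chain[of x] by (simp add: markov_chain_def)

lemma measurable_chain [measurable]: "X t \<in> measurable (P x) (count_space UNIV)"
  using chain[of x] by (simp add: markov_chain_def)

lemma measurable_return_time [measurable]:
  "return_time X y \<in> measurable (P x) (count_space UNIV)"
proof -
  \<comment> \<open>The index set of this infimum is countable and no longer depends on
    \<open>\<omega>\<close>, which gives measurability.\<close>
  have *: "return_time X y = (\<lambda>\<omega>. INF t. if 1 \<le> t \<and> X t \<omega> = y then enat t else \<infinity>)"
    unfolding return_time_def
  proof (intro ext antisym INF_greatest)
    fix \<omega> t assume "t \<in> {t. 1 \<le> t \<and> X t \<omega> = y}"
    then show "(INF t. if 1 \<le> t \<and> X t \<omega> = y then enat t else \<infinity>) \<le> enat t"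
      by (intro INF_lower2[of t]) auto
  qed (auto intro: INF_lower)
  show ?thesis unfolding * by measurable
qed

lemma prob_less_return_time:
  "\<P>(\<omega> in P x. enat n < return_time X y \<omega>) = avoid s F y n x"
proof -
  interpret prob_space "P x" by (rule prob_space_chain)
  have start: "\<P>(\<omega> in P x. X 0 \<omega> = x) = 1"
    using family by (simp add: markov_family_def)
  then have "AE \<omega> in P x. X 0 \<omega> = x"
    by (subst (asm) prob_eq_1) auto
  then have "\<P>(\<omega> in P x. enat n < return_time X y \<omega>) =
      \<P>(\<omega> in P x. (\<forall>i\<le>0. X i \<omega> = x) \<and> (\<forall>i\<in>{0<..0+n}. X i \<omega> \<noteq> y))"
    by (intro finite_measure_eq_AE) (auto simp: less_return_time_iff)
  also have "\<dots> = \<P>(\<omega> in P x. \<forall>i\<le>0. X i \<omega> = x) * avoid s F y n x"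
    by (rule markov_chain_avoid[OF chain fin stoch, where x = "\<lambda>_. x" and t = 0])
  finally show ?thesis using start by simp
qed

text \<open>Continuity from above: the events \<open>enat n < return_time X y \<omega>\<close>
  decrease to the event of no return.\<close>

lemma avoid_tendsto:
  "(\<lambda>n. avoid s F y n x) \<longlonglongrightarrow> 1 - \<P>(\<omega> in P x. return_time X y \<omega> < \<infinity>)"
proof -
  interpret prob_space "P x" by (rule prob_space_chain)
  define A where "A n = {\<omega>\<in>space (P x). enat n < return_time X y \<omega>}" for n
  have "decseq A"
    unfolding A_def less_return_time_iff by (intro decseq_SucI Collect_mono) simp
  moreover have "range A \<subseteq> events"
    unfolding A_def by (intro image_subsetI) measurable
  ultimately have "(\<lambda>n. prob (A n)) \<longlonglongrightarrow> prob (\<Inter>n. A n)"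
    by (intro finite_Lim_measure_decseq)
  moreover have "(\<Inter>n. A n) = space (P x) - {\<omega>\<in>space (P x). return_time X y \<omega> < \<infinity>}"
  proof -
    have "(\<forall>n. enat n < t) \<longleftrightarrow> \<not> t < \<infinity>" for t :: enat
      by (cases t) auto
    then show ?thesis unfolding A_def by blast
  qed
  moreover have "prob (A n) = avoid s F y n x" for n
    unfolding A_def by (rule prob_less_return_time)
  ultimately show ?thesis by (simp add: prob_compl)
qed

text \<open>Tail sum formula for the mean of a variable with values in \<open>enat\<close>.\<close>

lemma nn_integral_return_time:
  "(\<integral>\<^sup>+\<omega>. ennreal_of_enat (return_time X y \<omega>) \<partial>P x) = (\<Sum>n. ennreal (avoid s F y n x))"
proof -
  interpret prob_space "P x" by (rule prob_space_chain)
  show ?thesis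
    by (subst nn_integral_enat_function) (simp_all add: emeasure_eq_measure prob_less_return_time)
qed

lemma avoid_bounds: "0 \<le> avoid s F y n x" "avoid s F y n x \<le> 1"
proof -
  interpret prob_space "P x" by (rule prob_space_chain)
  show "0 \<le> avoid s F y n x" "avoid s F y n x \<le> 1"
    by (simp_all flip: prob_less_return_time)
qed

end


section \<open>The adding machine with fallible counter\<close>

text \<open>Adding 1 to \<open>n\<close> carries through the lowest \<open>r\<close> positions
  exactly when these digits are all \<open>d - 1\<close>, that is, when \<open>n + 1\<close> is 0
  modulo \<open>d ^ r\<close>. Divisibility replaces digits from here on.\<close>

lemma less_zeta_iff:
  assumes "d \<ge> 2"
  shows "r < zeta d n \<longleftrightarrow> d ^ r dvd n + 1"
proof -
  have step: "d ^ Suc r dvd n + 1 \<longleftrightarrow> d ^ r dvd n + 1 \<and> digit d n (Suc r) = d - 1" for r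
  proof (cases "d ^ r dvd n + 1")
    case True
    then obtain q where q: "n + 1 = d ^ r * q" by (auto elim: dvdE)
    then have "q > 0" by (cases q) auto
    have pos: "d ^ r > 0" using assms by simp
    have "n = d ^ r * (q - 1) + (d ^ r - 1)"
      using q \<open>q > 0\<close> pos by (cases q) auto
    then have "n div d ^ r = q - 1"
      using pos by (metis div_mult_self4 div_less diff_less zero_less_one add.commute add_0 less_numeral_extra(3))
    moreover have "d dvd q \<longleftrightarrow> (q - 1) mod d = d - 1"
    proof -
      have "Suc (q - 1) mod d = (if Suc ((q - 1) mod d) = d then 0 else Suc ((q - 1) mod d))"
        by (rule mod_Suc)
      then show ?thesis using \<open>q > 0\<close> assms by (auto simp: dvd_eq_mod_eq_0 split: if_splits)
    qed
    moreover have "d ^ Suc r dvd n + 1 \<longleftrightarrow> d dvd q"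
    proof -
      have "d ^ r * d dvd d ^ r * q \<longleftrightarrow> d dvd q"
        using assms by auto
      then show ?thesis by (simp only: q power_Suc2)
    qed
    ultimately show ?thesis using True by (simp add: digit_def)
  next
    case False
    then show ?thesis by (auto dest: dvd_mult_right)
  qed
  have all: "d ^ r dvd n + 1 \<longleftrightarrow> (\<forall>j\<in>{1..r}. digit d n j = d - 1)" for r
  proof (induction r)
    case (Suc r)
    have "{1..Suc r} = insert (Suc r) {1..r}" by auto
    with Suc step[of r] show ?case by auto
  qed simp
  \<comment> \<open>Makes the \<open>LEAST\<close> in \<open>zeta\<close> meaningful: otherwise
    \<open>d ^ Suc n\<close> would divide the smaller number \<open>n + 1\<close>.\<close>
  have "\<exists>j. 1 \<le> j \<and> digit d n j \<noteq> d - 1"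
  proof (rule ccontr)
    assume "\<not> ?thesis"
    then have "d ^ Suc n dvd n + 1" using all[of "Suc n"] by auto
    then have "d ^ Suc n \<le> n + 1" by (rule dvd_imp_le) simp
    moreover have "Suc n < 2 ^ Suc n" by (rule less_exp)
    moreover have "(2::nat) ^ Suc n \<le> d ^ Suc n" using assms by (rule power_mono) simp
    ultimately show False by simp
  qed
  then have z: "1 \<le> zeta d n \<and> digit d n (zeta d n) \<noteq> d - 1"
    unfolding zeta_def by (rule LeastI_ex)
  moreover have "digit d n j = d - 1" if "1 \<le> j" "j < zeta d n" for j
    using not_less_Least[OF that(2)[unfolded zeta_def]] that by auto
  ultimately show ?thesis unfolding all
    by (metis atLeastAtMost_iff le_less_trans not_le)
qed

section \<open>One-step operator and counting measure\<close>

locale fallible_counter =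
  fixes d :: nat and p :: "nat \<Rightarrow> real"
  assumes d: "d \<ge> 2" and p: "\<And>j. j \<ge> 1 \<Longrightarrow> 0 < p j \<and> p j \<le> 1"
begin

text \<open>\<open>reach n\<close> is the chance that the first \<open>n\<close> counters work,
  \<open>fail r\<close> the chance that counter \<open>r + 1\<close> is the first to fail, and
  \<open>trans_op f x\<close> the mean of \<open>f\<close> after one step from
  \<open>x\<close>.\<close>

abbreviation reach :: "nat \<Rightarrow> real" where "reach n \<equiv> \<Prod>j=1..n. p j"
abbreviation fail :: "nat \<Rightarrow> real" where "fail r \<equiv> reach r - reach (Suc r)"
abbreviation trans_op :: "(nat \<Rightarrow> real) \<Rightarrow> nat \<Rightarrow> real" where
  "trans_op f x \<equiv> \<Sum>z\<le>Suc x. amfc d p x z * f z"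

lemma reach_pos: "0 < reach n"
  by (rule prod_pos) (simp add: p)

lemma fail_nonneg: "0 \<le> fail r"
  using reach_pos[of r] p[of "Suc r"] mult_left_le[of "p (Suc r)" "reach r"] by simp

lemma sum_fail: "(\<Sum>r<n. fail r) = 1 - reach n"
  by (subst sum_lessThan_telescope') simp

lemma reach_antimono: "antimono reach"
  using fail_nonneg by (intro decseq_SucI) simp

lemma d_power_less: "Suc n < d ^ Suc n"
proof -
  have "Suc n < 2 ^ Suc n" by (rule less_exp)
  also have "(2::nat) ^ Suc n \<le> d ^ Suc n" using d by (rule power_mono) simp
  finally show ?thesis .
qed

lemma zeta_power: "zeta d (d ^ k - 1) = Suc k"
proof -
  have "r < zeta d (d ^ k - 1) \<longleftrightarrow> r < Suc k" for r
  proof -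
    have "d ^ r dvd d ^ k \<longleftrightarrow> r \<le> k"
      using d by (metis dvd_power_iff_le)
    then show ?thesis using d by (simp add: less_zeta_iff[OF d] less_Suc_eq_le)
  qed
  then show ?thesis by (metis linorder_neqE_nat less_irrefl)
qed

lemma zeta_pos: "0 < zeta d n"
  by (simp add: less_zeta_iff[OF d])

lemma sum_top_digits: "(\<Sum>j=1..r. (d - 1) * d ^ (j - 1)) = d ^ r - 1"
proof (induction r)
  case (Suc r)
  have "(d - 1) * d ^ r + (d ^ r - 1) = d * d ^ r - 1"
    using d by (cases d) (auto simp: algebra_simps)
  with Suc show ?case by simp
qed simp

text \<open>If counter \<open>r + 1\<close> is the first to fail, \<open>r\<close> digits have been
  reset and the target is \<open>Suc x - d ^ r\<close>. As \<open>d ^ 0 = 1\<close>, holding is the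
  case \<open>r = 0\<close>, and one sum treats all failures.\<close>

lemma amfc_eq:
  "amfc d p x z = of_bool (z = Suc x) * reach (zeta d x) +
    (\<Sum>r<zeta d x. of_bool (z = Suc x - d ^ r) * fail r)"
proof -
  have le: "d ^ r \<le> Suc x" if "r < zeta d x" for r
    using that by (simp add: less_zeta_iff[OF d] dvd_imp_le)
  have gt: "2 \<le> d ^ r" if "1 \<le> r" for r
    using that d power_increasing[of 1 r d] by simp
  have gt': "2 \<le> d ^ Suc r" for r using gt[of "Suc r"] by simp
  obtain m where m: "zeta d x = Suc m" using zeta_pos[of x] gr0_implies_Suc by blast
  have *: "(\<Sum>r<zeta d x. of_bool (z = Suc x - d ^ r) * fail r) = of_bool (z = x) * (1 - p 1) +
     (\<Sum>r<zeta d x - 1. of_bool (z = Suc x - d ^ Suc r) * fail (Suc r))"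
    unfolding m by (subst sum.lessThan_Suc_shift) simp
  have ** : "{r. 1 \<le> r \<and> r \<le> zeta d x - 1 \<and> z + (\<Sum>j=1..r. (d - 1) * d ^ (j - 1)) = x} =
      Suc ` {r. r < zeta d x - 1 \<and> z = Suc x - d ^ Suc r}"
  proof -
    have eq: "z + (d ^ Suc r - 1) = x \<longleftrightarrow> z = Suc x - d ^ Suc r" if "r < zeta d x - 1" for r
      using le[of "Suc r"] gt'[of r] that by linarith
    have "{r. 1 \<le> r \<and> r \<le> n \<and> Q r} = Suc ` {r. r < n \<and> R r}"
      if "\<And>r. r < n \<Longrightarrow> Q (Suc r) \<longleftrightarrow> R r" for n Q R
      using that by (auto simp: image_iff gr0_conv_Suc Suc_le_eq)
    then show ?thesis unfolding sum_top_digits using eq .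
  qed
  have "(\<Sum>r | 1 \<le> r \<and> r \<le> zeta d x - 1 \<and> z + (\<Sum>j=1..r. (d - 1) * d ^ (j - 1)) = x.
      (1 - p (r + 1)) * reach r) = (\<Sum>r<zeta d x - 1. of_bool (z = Suc x - d ^ Suc r) * fail (Suc r))"
    unfolding ** by (simp add: sum.reindex, rule sum.mono_neutral_cong_left)
      (auto simp: algebra_simps)
  \<comment> \<open>The case order in \<open>amfc\<close> does not matter: resetting at least one
    digit leads strictly below \<open>x\<close>.\<close>
  moreover have "(\<Sum>r<zeta d x - 1. of_bool (z = Suc x - d ^ Suc r) * fail (Suc r)) = 0"
    if "z = x \<or> z = Suc x"
  proof (intro sum.neutral ballI)
    fix r assume "r \<in> {..<zeta d x - 1}"
    then have "d ^ Suc r \<le> Suc x" by (intro le) auto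
    then have "z \<noteq> Suc x - d ^ Suc r"
      using that gt'[of r] by linarith
    then show "of_bool (z = Suc x - d ^ Suc r) * fail (Suc r) = 0" by simp
  qed
  ultimately show ?thesis unfolding amfc_def * by auto
qed

lemma amfc_nonneg: "0 \<le> amfc d p x z"
  unfolding amfc_eq using reach_pos fail_nonneg
  by (intro add_nonneg_nonneg sum_nonneg mult_nonneg_nonneg) (auto intro: less_imp_le)

lemma trans_op_eq:
  "trans_op f x = reach (zeta d x) * f (Suc x) + (\<Sum>r<zeta d x. fail r * f (Suc x - d ^ r))"
proof -
  have "trans_op f x = (\<Sum>z\<le>Suc x. of_bool (z = Suc x) * (reach (zeta d x) * f z)) +
      (\<Sum>z\<le>Suc x. \<Sum>r<zeta d x. of_bool (z = Suc x - d ^ r) * (fail r * f z))"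
    unfolding amfc_eq sum.distrib[symmetric] by (simp add: algebra_simps sum_distrib_left)
  also have "(\<Sum>z\<le>Suc x. \<Sum>r<zeta d x. of_bool (z = Suc x - d ^ r) * (fail r * f z)) =
      (\<Sum>r<zeta d x. \<Sum>z\<le>Suc x. of_bool (z = Suc x - d ^ r) * (fail r * f z))"
    by (rule sum.swap)
  also have "\<dots> = (\<Sum>r<zeta d x. fail r * f (Suc x - d ^ r))"
  proof (intro sum.cong refl)
    fix r
    have "Suc x - d ^ r \<in> {..Suc x}" by simp
    then show "(\<Sum>z\<le>Suc x. of_bool (z = Suc x - d ^ r) * (fail r * f z)) = fail r * f (Suc x - d ^ r)"
      by (simp only: of_bool_def if_distrib[of "\<lambda>u. u * _"] mult_1 mult_zero_left sum.delta finite_atMost if_True)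
  qed
  finally show ?thesis
    by (simp add: of_bool_def if_distrib[of "\<lambda>u. u * _"] sum.delta cong: if_cong)
qed

lemma trans_op_const: "trans_op (\<lambda>_. c) x = c"
  unfolding trans_op_eq by (simp only: sum_distrib_right[symmetric] sum_fail) (simp add: algebra_simps)

text \<open>For each \<open>r \<le> K\<close>, the failures at counter \<open>r + 1\<close> change
  the sum by differences of \<open>f\<close> along consecutive multiples of \<open>d ^ r\<close>,
  which telescope to \<open>f 0 - f (d ^ K)\<close> whatever \<open>r\<close> is. Their weights add
  up to \<open>1 - reach (Suc K)\<close>; the shift \<open>x\<close> to \<open>Suc x\<close>
  contributes the opposite difference with weight 1.\<close>

lemma sum_trans_op:
  "(\<Sum>x<d ^ K. trans_op f x) = (\<Sum>x<d ^ K. f x) + reach (Suc K) * (f (d ^ K) - f 0)"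
proof -
  let ?N = "d ^ K"
  \<comment> \<open>A failure is written as a correction to the step up. Below \<open>d ^ K\<close>
    one has \<open>zeta d x \<le> Suc K\<close>, so an indicator can replace the range depending on
    \<open>x\<close>, and the two sums can be swapped.\<close>
  have row: "trans_op f x = f (Suc x) + (\<Sum>r<Suc K. fail r * (of_bool (d ^ r dvd Suc x) * (f (Suc x - d ^ r) - f (Suc x))))"
    if "x < ?N" for x
  proof -
    have "zeta d x \<le> Suc K"
    proof (rule ccontr)
      assume "\<not> ?thesis"
      then have "d ^ Suc K dvd Suc x" using less_zeta_iff[OF d, of "Suc K" x] by simp
      then have "d ^ Suc K \<le> Suc x" by (rule dvd_imp_le) simp
      moreover have "d ^ K < d ^ Suc K" using d by simp
      ultimately show False using that by linarith
    qed
    then have "(\<Sum>r<Suc K. fail r * (of_bool (d ^ r dvd Suc x) * (f (Suc x - d ^ r) - f (Suc x)))) =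
        (\<Sum>r<zeta d x. fail r * (f (Suc x - d ^ r) - f (Suc x)))"
      using less_zeta_iff[OF d, of _ x, symmetric] by (intro sum.mono_neutral_cong_right) auto
    also have "\<dots> = (\<Sum>r<zeta d x. fail r * f (Suc x - d ^ r)) - (1 - reach (zeta d x)) * f (Suc x)"
      unfolding sum_fail[symmetric] by (simp only: right_diff_distrib sum_subtractf[symmetric] sum_distrib_right)
    finally show ?thesis unfolding trans_op_eq by (simp add: algebra_simps)
  qed
  have col: "(\<Sum>x<?N. of_bool (d ^ r dvd Suc x) * (f (Suc x - d ^ r) - f (Suc x))) = f 0 - f ?N"
    if "r < Suc K" for r
  proof -
    have pos: "d ^ r > 0" using d by simp
    have N: "?N = d ^ r * d ^ (K - r)" using that by (simp flip: power_add)
    have "(\<Sum>x<?N. of_bool (d ^ r dvd Suc x) * (f (Suc x - d ^ r) - f (Suc x))) =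
        (\<Sum>x\<in>(\<lambda>i. d ^ r * Suc i - 1) ` {..<d ^ (K - r)}. f (Suc x - d ^ r) - f (Suc x))"
    proof (intro sum.mono_neutral_cong_right ballI)
      show "(\<lambda>i. d ^ r * Suc i - 1) ` {..<d ^ (K - r)} \<subseteq> {..<?N}"
      proof safe
        fix i assume "i < d ^ (K - r)"
        then have "d ^ r * Suc i \<le> ?N" unfolding N by (intro mult_le_mono2) simp
        moreover have "0 < d ^ r * Suc i" using pos by simp
        ultimately show "d ^ r * Suc i - 1 < ?N" by linarith
      qed
      fix x
      assume x: "x \<in> {..<?N} - (\<lambda>i. d ^ r * Suc i - 1) ` {..<d ^ (K - r)}"
      have "\<not> d ^ r dvd Suc x"
      proof
        assume "d ^ r dvd Suc x"
        then obtain i where i: "Suc x = d ^ r * i" by (elim dvdE)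
        then obtain i' where i': "i = Suc i'" by (cases i) auto
        have "Suc x \<le> ?N" using x by simp
        then have "d ^ r * Suc i' \<le> d ^ r * d ^ (K - r)" unfolding N i i' .
        then have "i' < d ^ (K - r)" using pos unfolding mult_le_cancel1 by linarith
        moreover have "x = d ^ r * Suc i' - 1" using i i' by (metis diff_Suc_1)
        ultimately show False using x by blast
      qed
      then show "of_bool (d ^ r dvd Suc x) * (f (Suc x - d ^ r) - f (Suc x)) = 0" by simp
    next
      fix x assume "x \<in> (\<lambda>i. d ^ r * Suc i - 1) ` {..<d ^ (K - r)}"
      then obtain i where "x = d ^ r * Suc i - 1" by blast
      then have "Suc x = d ^ r * Suc i" using pos by simp
      then show "of_bool (d ^ r dvd Suc x) * (f (Suc x - d ^ r) - f (Suc x)) = f (Suc x - d ^ r) - f (Suc x)"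
        by simp
    qed simp
    also have "\<dots> = (\<Sum>i<d ^ (K - r). f (d ^ r * i) - f (d ^ r * Suc i))"
    proof (subst sum.reindex)
      have S: "Suc (d ^ r * Suc i - 1) = d ^ r * Suc i" for i
        using pos by simp
      show "inj_on (\<lambda>i. d ^ r * Suc i - 1) {..<d ^ (K - r)}"
      proof (rule inj_onI)
        fix i j assume "d ^ r * Suc i - 1 = d ^ r * Suc j - 1"
        then have "d ^ r * Suc i = d ^ r * Suc j" using S by metis
        then show "i = j" using d by auto
      qed
      show "sum ((\<lambda>x. f (Suc x - d ^ r) - f (Suc x)) \<circ> (\<lambda>i. d ^ r * Suc i - 1)) {..<d ^ (K - r)} =
          (\<Sum>i<d ^ (K - r). f (d ^ r * i) - f (d ^ r * Suc i))"
        by (intro sum.cong refl) (simp only: o_apply S, simp)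
    qed
    also have "\<dots> = f 0 - f ?N"
      by (subst sum_lessThan_telescope'[of "\<lambda>i. f (d ^ r * i)"]) (simp add: N)
    finally show ?thesis .
  qed
  have "(\<Sum>x<?N. trans_op f x) = (\<Sum>x<?N. f (Suc x)) +
      (\<Sum>x<?N. \<Sum>r<Suc K. fail r * (of_bool (d ^ r dvd Suc x) * (f (Suc x - d ^ r) - f (Suc x))))"
    using row by (simp add: sum.distrib)
  also have "(\<Sum>x<?N. \<Sum>r<Suc K. fail r * (of_bool (d ^ r dvd Suc x) * (f (Suc x - d ^ r) - f (Suc x)))) =
      (\<Sum>r<Suc K. fail r * (\<Sum>x<?N. of_bool (d ^ r dvd Suc x) * (f (Suc x - d ^ r) - f (Suc x))))"
    by (subst sum.swap) (simp only: sum_distrib_left)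
  also have "\<dots> = (\<Sum>r<Suc K. fail r * (f 0 - f ?N))"
    using col by (intro sum.cong refl) (simp only: lessThan_iff)
  also have "\<dots> = (1 - reach (Suc K)) * (f 0 - f ?N)"
    unfolding sum_fail[symmetric] by (simp only: sum_distrib_right)
  also have "(\<Sum>x<?N. f (Suc x)) = (\<Sum>x<?N. f x) + (f ?N - f 0)"
  proof -
    have "(\<Sum>x<?N. f (Suc x) - f x) = f ?N - f 0" by (rule sum_lessThan_telescope)
    then show ?thesis by (simp add: sum_subtractf)
  qed
  finally show ?thesis by (simp only: algebra_simps)
qed

section \<open>Recurrence when the product vanishes\<close>

abbreviation survival :: "nat \<Rightarrow> nat \<Rightarrow> nat \<Rightarrow> real" where
  "survival y n x \<equiv> avoid (amfc d p) (\<lambda>x. {..Suc x}) y n x"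

text \<open>A function vanishing at \<open>y\<close> that is harmonic elsewhere is nondecreasing, and it gains at
  least the factor \<open>1 / p (k + 1)\<close> between \<open>d ^ (k - 1)\<close> and \<open>d ^ k\<close>, because a failure of the
  counter \<open>k + 1\<close> leads back to 0, where the function vanishes.\<close>

lemma bounded_harmonic_eq_0:
  assumes lim: "reach \<longlonglongrightarrow> 0"
    and bounds: "\<And>x. 0 \<le> h x" "\<And>x. h x \<le> 1"
    and y: "h y = 0" and harmonic: "\<And>x. x \<noteq> y \<Longrightarrow> h x = trans_op h x"
  shows "h x = 0"
proof -
  \<comment> \<open>From \<open>n < y\<close> every target but \<open>Suc n\<close> is at most
    \<open>n\<close>, where \<open>h\<close> equals \<open>h 0\<close>; harmonicity then forces
    \<open>h (Suc n) = h 0\<close>. With \<open>h y = 0\<close> this gives 0 on all of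
    \<open>{..y}\<close>.\<close>
  have const: "n \<le> y \<Longrightarrow> \<forall>m\<le>n. h m = h 0" for n
  proof (induction n)
    case (Suc n)
    then have IH: "\<And>m. m \<le> n \<Longrightarrow> h m = h 0" using Suc_leD by blast
    have "h n = trans_op h n" using Suc.prems by (intro harmonic) simp
    also have "\<dots> = reach (zeta d n) * h (Suc n) + (\<Sum>r<zeta d n. fail r * h 0)"
    proof -
      have "h (Suc n - d ^ r) = h 0" for r
      proof (rule IH)
        have "0 < d ^ r" using d by simp
        then show "Suc n - d ^ r \<le> n" by linarith
      qed
      then show ?thesis unfolding trans_op_eq by (simp only:)
    qed
    also have "\<dots> = reach (zeta d n) * h (Suc n) + (1 - reach (zeta d n)) * h 0"
      unfolding sum_fail[symmetric] by (simp only: sum_distrib_right)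
    finally have "reach (zeta d n) * h (Suc n) = reach (zeta d n) * h 0"
      using IH[of n] by (simp add: left_diff_distrib)
    then have "h (Suc n) = h 0" using reach_pos[of "zeta d n"] by (metis mult_left_cancel less_irrefl)
    with IH show ?case by (metis le_SucE)
  qed simp
  then have zero: "h m = 0" if "m \<le> y" for m using that y by (metis order_refl)
  \<comment> \<open>The first \<open>m\<close> failures lead to states at most \<open>n\<close> and
    are estimated by \<open>h n\<close>. Taking \<open>m = zeta d n\<close> gives monotonicity; at
    \<open>d ^ Suc k - 1\<close>, taking \<open>m = Suc k\<close> leaves only the failure leading to
    0.\<close>
  have step: "h n * reach m \<le> h (Suc n) * reach (zeta d n) + (\<Sum>r\<in>{m..<zeta d n}. fail r * h (Suc n - d ^ r))"
    if "n \<noteq> y" "m \<le> zeta d n" "\<And>i. i \<le> n \<Longrightarrow> h i \<le> h n" for n m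
  proof -
    have "h n = trans_op h n" using that(1) by (rule harmonic)
    also have "\<dots> = reach (zeta d n) * h (Suc n) + ((\<Sum>r<m. fail r * h (Suc n - d ^ r)) +
        (\<Sum>r\<in>{m..<zeta d n}. fail r * h (Suc n - d ^ r)))"
      unfolding trans_op_eq lessThan_atLeast0 using that(2) by (subst sum.atLeastLessThan_concat) auto
    also have "(\<Sum>r<m. fail r * h (Suc n - d ^ r)) \<le> (\<Sum>r<m. fail r * h n)"
    proof (intro sum_mono mult_left_mono fail_nonneg that(3))
      fix r
      have "0 < d ^ r" using d by simp
      then show "Suc n - d ^ r \<le> n" by linarith
    qed
    also have "\<dots> = (1 - reach m) * h n"
      unfolding sum_fail[symmetric] by (simp only: sum_distrib_right)
    finally show ?thesis by (simp add: algebra_simps)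
  qed
  have mono_aux: "\<forall>m\<le>n. h m \<le> h n" for n
  proof (induction n)
    case (Suc n)
    have "h n \<le> h (Suc n)"
    proof (cases "n = y")
      case True
      then show ?thesis using y bounds(1) by simp
    next
      case False
      then have "h n * reach (zeta d n) \<le> h (Suc n) * reach (zeta d n)"
        using step[of n "zeta d n"] Suc.IH by simp
      then show ?thesis using reach_pos[of "zeta d n"] by simp
    qed
    with Suc show ?case by (auto simp: le_Suc_eq intro: order_trans)
  qed simp
  then have mono: "h m \<le> h n" if "m \<le> n" for m n using that by blast
  \<comment> \<open>Keeps the end of a block away from \<open>y\<close>, so that \<open>h\<close> is
    harmonic there.\<close>
  have big: "y < d ^ k - 1" if "y < k" for k
  proof -
    obtain k' where "k = Suc k'" using \<open>y < k\<close> by (cases k) auto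
    then show ?thesis using d_power_less[of k'] that by simp
  qed
  \<comment> \<open>The gain of \<open>h\<close> makes \<open>a\<close> nondecreasing from
    \<open>y\<close> on, while \<open>h \<le> 1\<close> puts it below \<open>reach (Suc k)\<close>,
    which tends to 0.\<close>
  define a where "a k = reach (Suc k) * h (d ^ k)" for k
  have a_mono: "a k \<le> a (Suc k)" if "y \<le> k" for k
  proof -
    let ?n = "d ^ Suc k - 1"
    have n: "Suc ?n = d ^ Suc k" using d by simp
    have "d ^ k \<le> ?n"
    proof -
      have "d ^ k < d ^ Suc k" using d by simp
      then show ?thesis by linarith
    qed
    then have "a k \<le> h ?n * reach (Suc k)"
      unfolding a_def mult.commute[of "reach (Suc k)"]
      using mono[of "d ^ k" ?n] reach_pos[of "Suc k"]
      by (intro mult_right_mono less_imp_le[OF reach_pos]) auto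
    also have "\<dots> \<le> h (Suc ?n) * reach (zeta d ?n) + (\<Sum>r\<in>{Suc k..<zeta d ?n}. fail r * h (Suc ?n - d ^ r))"
      using big[of "Suc k"] that mono by (intro step) (simp_all only: zeta_power, auto)
    also have "\<dots> = a (Suc k)"
      unfolding n zeta_power using zero[of 0] by (simp add: a_def mult.commute)
    finally show ?thesis .
  qed
  have "a \<longlonglongrightarrow> 0"
  proof (rule tendsto_sandwich)
    show "\<forall>\<^sub>F k in sequentially. 0 \<le> a k"
      unfolding a_def using reach_pos bounds(1) by (intro always_eventually allI mult_nonneg_nonneg less_imp_le[OF reach_pos])
    show "\<forall>\<^sub>F k in sequentially. a k \<le> reach (Suc k)"
      unfolding a_def using reach_pos bounds by (intro always_eventually allI mult_left_le less_imp_le[OF reach_pos])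
    show "(\<lambda>k. reach (Suc k)) \<longlonglongrightarrow> 0" using lim by (rule LIMSEQ_Suc)
  qed simp
  then have "(\<lambda>n. a (n + (y + x))) \<longlonglongrightarrow> 0" by (rule LIMSEQ_ignore_initial_segment)
  moreover have "incseq (\<lambda>n. a (n + (y + x)))"
    using a_mono by (intro incseq_SucI) simp
  ultimately have "a (0 + (y + x)) \<le> 0" using incseq_le by blast
  then have "h (d ^ (y + x)) \<le> 0"
    using reach_pos[of "Suc (y + x)"] by (simp add: a_def mult_le_0_iff del: prod.cl_ivl_Suc)
  moreover have "x \<le> d ^ (y + x)"
  proof -
    have "y + x < 2 ^ (y + x)" by (rule less_exp)
    also have "(2::nat) ^ (y + x) \<le> d ^ (y + x)" using d by (rule power_mono) simp
    finally show ?thesis by simp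
  qed
  ultimately show ?thesis using mono[of x "d ^ (y + x)"] bounds(1)[of x] by linarith
qed

lemma trans_op_mono:
  assumes "\<And>z. z \<le> Suc x \<Longrightarrow> f z \<le> g z"
  shows "trans_op f x \<le> trans_op g x"
  using assms by (intro sum_mono mult_left_mono amfc_nonneg) auto

text \<open>Setting the value at \<open>y\<close> to 0 replaces omitting \<open>y\<close> from the
  sum, so that facts about \<open>trans_op\<close> apply.\<close>

lemma survival_Suc: "survival y (Suc n) x = trans_op ((survival y n)(y := 0)) x"
  unfolding avoid.simps by (rule sum.mono_neutral_cong_left) auto

lemma survival_bounds: "0 \<le> survival y n x \<and> survival y n x \<le> 1"
proof (induction n arbitrary: x)
  case (Suc n)
  have "trans_op (\<lambda>_. 0) x \<le> survival y (Suc n) x"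
    unfolding survival_Suc using Suc by (intro trans_op_mono) simp
  moreover have "survival y (Suc n) x \<le> trans_op (\<lambda>_. 1) x"
    unfolding survival_Suc using Suc by (intro trans_op_mono) simp
  ultimately show ?case by (simp only: trans_op_const)
qed simp

lemma survival_decseq: "decseq (\<lambda>n. survival y n x)"
proof (rule decseq_SucI)
  fix n
  show "survival y (Suc n) x \<le> survival y n x"
  proof (induction n arbitrary: x)
    case 0
    then show ?case using survival_bounds[of y "Suc 0" x] by simp
  next
    case (Suc n)
    then show ?case
      unfolding survival_Suc[of y "Suc n"] survival_Suc[of y n x] by (intro trans_op_mono) simp
  qed
qed

text \<open>One term of the recursion; it transfers decay and summability from \<open>x\<close> to
  the states reached from \<open>x\<close> in one step.\<close>

lemma amfc_mult_survival_le:
  assumes "z \<noteq> y" "z \<le> Suc x"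
  shows "amfc d p x z * survival y n z \<le> survival y (Suc n) x"
  unfolding avoid.simps using assms survival_bounds
  by (intro member_le_sum) (auto intro: mult_nonneg_nonneg amfc_nonneg)

lemma amfc_Suc_pos: "0 < amfc d p x (Suc x)"
  using reach_pos by (simp add: amfc_def)

text \<open>The decreasing limit \<open>q\<close> inherits the recursion because rows are finite.
  Set to 0 at \<open>y\<close>, it is bounded and harmonic off \<open>y\<close>, hence 0; one more
  step gives \<open>q = 0\<close> at \<open>y\<close> too.\<close>

lemma survival_tendsto_0:
  assumes "reach \<longlonglongrightarrow> 0"
  shows "(\<lambda>n. survival y n x) \<longlonglongrightarrow> 0"
proof -
  have "\<exists>l. (\<lambda>n. survival y n x) \<longlonglongrightarrow> l" for x
    using decseq_convergent[OF survival_decseq, of 0 y x] survival_bounds by metis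
  then obtain q where q: "\<And>x. (\<lambda>n. survival y n x) \<longlonglongrightarrow> q x" by metis
  let ?h = "q(y := 0)"
  have q_bounds: "0 \<le> q x" "q x \<le> 1" for x
    using survival_bounds by (auto intro: LIMSEQ_le_const[OF q] LIMSEQ_le_const2[OF q])
  have q_eq: "q x = trans_op ?h x" for x
  proof (rule LIMSEQ_unique)
    show "(\<lambda>n. survival y (Suc n) x) \<longlonglongrightarrow> q x" using q by (rule LIMSEQ_Suc)
    show "(\<lambda>n. survival y (Suc n) x) \<longlonglongrightarrow> trans_op ?h x"
      unfolding survival_Suc by (intro tendsto_sum tendsto_mult tendsto_const) (simp add: q)
  qed
  have "?h z = 0" for z
  proof (rule bounded_harmonic_eq_0[OF assms, where y = y])
    fix x assume "x \<noteq> y"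
    then have "?h x = q x" by simp
    then show "?h x = trans_op ?h x" using q_eq[of x] by (rule trans)
  qed (simp_all add: q_bounds)
  then have "q x = trans_op (\<lambda>_. 0) x" using q_eq[of x] by (simp only:)
  then have "q x = 0" by simp
  with q[of x] show ?thesis by simp
qed

section \<open>Transience when the product is positive\<close>

text \<open>On \<open>{d ^ k..}\<close> the function \<open>1 / reach (floorlog d x)\<close> is harmonic for the chain killed on
  entering \<open>{..<d ^ k}\<close>.\<close>

lemma survival_not_tendsto_0:
  assumes "\<not> reach \<longlonglongrightarrow> 0"
  shows "\<not> (\<lambda>n. survival y n y) \<longlonglongrightarrow> 0"
proof
  assume ret: "(\<lambda>n. survival y n y) \<longlonglongrightarrow> 0"
  obtain L where L: "reach \<longlonglongrightarrow> L"
    using decseq_convergent[OF reach_antimono, of 0] reach_pos by (metis less_imp_le)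
  have "0 \<le> L" using reach_pos by (intro LIMSEQ_le_const[OF L]) (auto intro: less_imp_le)
  with L assms have L_pos: "0 < L" by (cases "L = 0") auto
  have L_le: "L \<le> reach n" for n using decseq_ge[OF reach_antimono L] .
  \<comment> \<open>Puts \<open>y\<close> into the killed region, where \<open>g\<close>
    vanishes.\<close>
  define k where "k = Suc y"
  have yk: "y < d ^ k" using d_power_less[of y] by (simp add: k_def)
  define g where "g x = (if x < d ^ k then 0 else 1 / reach (floorlog d x))" for x
  have g_nonneg: "0 \<le> g x" for x
    using reach_pos by (simp add: g_def less_imp_le)
  have g_eq: "g x = 1 / reach (Suc j)" if "d ^ j \<le> x" "x < d ^ Suc j" "k \<le> j" for x j
  proof -
    have "d ^ k \<le> d ^ j" using that(3) d by (intro power_increasing) auto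
    moreover have "floorlog d x = Suc j"
      using that floorlog_leI[of x d "Suc j"] floorlog_ge_SucI[of d j x] d by simp
    ultimately show ?thesis using that by (simp add: g_def)
  qed
  have sub: "g x \<le> trans_op g x" for x
  proof (cases "x < d ^ k")
    case True
    have "trans_op (\<lambda>_. 0) x \<le> trans_op g x" by (rule trans_op_mono) (rule g_nonneg)
    then show ?thesis using True by (simp add: g_def)
  next
    case False
    have "d ^ k > 0" using d by simp
    then have "1 \<le> x" using False by linarith
    then obtain j where j: "d ^ j \<le> x" "x < d ^ Suc j"
      using ex_power_ivl1[OF d, of x] by auto
    have "d ^ k < d ^ Suc j" using j False by linarith
    then have kj: "k \<le> j" using d by (simp add: power_strict_increasing_iff del: power_Suc)
    let ?c = "1 / reach (Suc j)"
    \<comment> \<open>Both \<open>Suc x\<close> and \<open>d ^ j\<close> are multiples of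
      \<open>d ^ r\<close>, and \<open>Suc x\<close> is the larger one, so going down by
      \<open>d ^ r\<close> does not leave the block of \<open>x\<close>.\<close>
    have low: "g (Suc x - d ^ r) = ?c" if r: "r < zeta d x" "r \<le> j" for r
    proof (rule g_eq)
      have "d ^ r dvd Suc x" using r(1) by (simp add: less_zeta_iff[OF d])
      moreover have dj: "d ^ r dvd d ^ j" using r(2) by (rule le_imp_power_dvd)
      ultimately have "d ^ r dvd Suc x - d ^ j" by (rule dvd_diff_nat)
      then have "d ^ r \<le> Suc x - d ^ j" using j(1) by (intro dvd_imp_le) auto
      then show "d ^ j \<le> Suc x - d ^ r" using j(1) by linarith
      have "0 < d ^ r" using d by simp
      then show "Suc x - d ^ r < d ^ Suc j" using j(2) by linarith
    qed (fact kj)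
    show ?thesis
    \<comment> \<open>At the end of the block, climbing contributes exactly 1 and the failures
      within the block \<open>?c - 1\<close>. Inside the block all targets have the value
      \<open>?c\<close>.\<close>
    proof (cases "Suc x = d ^ Suc j")
      case True
      then have x: "x = d ^ Suc j - 1" by simp
      have z: "zeta d x = Suc (Suc j)" unfolding x by (rule zeta_power)
      have "d ^ Suc j < d ^ Suc (Suc j)" using d by simp
      then have "g (Suc x) = 1 / reach (Suc (Suc j))"
        using True kj by (intro g_eq) auto
      moreover have cancel: "c * (1 / c) = 1" if "0 < c" for c :: real using that by simp
      ultimately have "reach (zeta d x) * g (Suc x) = 1"
        unfolding z using reach_pos[of "Suc (Suc j)"] by (simp only:)
      moreover have "(\<Sum>r<Suc j. fail r * ?c) \<le> (\<Sum>r<Suc (Suc j). fail r * g (Suc x - d ^ r))"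
      proof -
        have "(\<Sum>r<Suc j. fail r * ?c) = (\<Sum>r<Suc j. fail r * g (Suc x - d ^ r))"
          using low z by (intro sum.cong refl) simp
        then show ?thesis
          using fail_nonneg[of "Suc j"] g_nonneg by (subst (2) sum.lessThan_Suc) simp
      qed
      moreover have "(\<Sum>r<Suc j. fail r * ?c) = (1 - reach (Suc j)) * ?c"
        unfolding sum_fail[symmetric] by (simp only: sum_distrib_right)
      moreover have "(1 - reach (Suc j)) * ?c = ?c - 1"
        using cancel[OF reach_pos[of "Suc j"]] by (simp only: left_diff_distrib mult_1)
      ultimately have "?c \<le> trans_op g x" unfolding trans_op_eq z by linarith
      then show ?thesis using g_eq[OF j kj] by simp
    next
      case False
      then have "g (Suc x) = ?c" using j kj by (intro g_eq) auto
      moreover have "r \<le> j" if "r < zeta d x" for r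
      proof -
        have "d ^ r dvd Suc x" using that by (simp add: less_zeta_iff[OF d])
        then have "d ^ r \<le> Suc x" by (rule dvd_imp_le) simp
        then have "d ^ r < d ^ Suc j" using False j(2) by linarith
        then show ?thesis using d by (simp add: power_strict_increasing_iff del: power_Suc)
      qed
      ultimately have "trans_op g x = trans_op (\<lambda>_. ?c) x"
        unfolding trans_op_eq using low by (simp del: prod.cl_ivl_Suc)
      then show ?thesis using g_eq[OF j kj] by (simp only: trans_op_const order_refl)
    qed
  qed
  \<comment> \<open>The factor \<open>L\<close> brings \<open>g\<close> below 1, the starting value
    of the recursion.\<close>
  have below: "L * g x \<le> survival y n x" for n x
  proof (induction n arbitrary: x)
    case 0
    show ?case using L_le[of "floorlog d x"] reach_pos[of "floorlog d x"] by (simp add: g_def)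
  next
    case (Suc n)
    have "L * g x \<le> L * trans_op g x" using sub L_pos by simp
    also have "\<dots> = trans_op (\<lambda>z. L * g z) x"
      unfolding sum_distrib_left by (simp only: mult.left_commute)
    also have "\<dots> \<le> survival y (Suc n) x"
      unfolding survival_Suc using Suc yk by (intro trans_op_mono) (simp add: g_def)
    finally show ?case .
  qed
  \<comment> \<open>Decay at \<open>y\<close> would spread upwards by steps of 1 to
    \<open>d ^ k\<close>, where \<open>L * g\<close> is a positive lower bound.\<close>
  have up: "(\<lambda>n. survival y n (y + i)) \<longlonglongrightarrow> 0" for i
  proof (induction i)
    case 0
    then show ?case using ret by simp
  next
    case (Suc i)
    let ?s = "amfc d p (y + i) (Suc (y + i))"
    have "(\<lambda>n. ?s * survival y n (Suc (y + i))) \<longlonglongrightarrow> 0"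
    proof (rule tendsto_sandwich)
      show "\<forall>\<^sub>F n in sequentially. 0 \<le> ?s * survival y n (Suc (y + i))"
        using amfc_nonneg survival_bounds by simp
      show "\<forall>\<^sub>F n in sequentially. ?s * survival y n (Suc (y + i)) \<le> survival y (Suc n) (y + i)"
        by (intro always_eventually allI amfc_mult_survival_le) auto
      show "(\<lambda>n. survival y (Suc n) (y + i)) \<longlonglongrightarrow> 0" using Suc by (rule LIMSEQ_Suc)
    qed simp
    then have "(\<lambda>n. survival y n (Suc (y + i))) \<longlonglongrightarrow> 0"
      using amfc_Suc_pos[of "y + i"] tendsto_mult_left_iff[of ?s _ 0] by simp
    then show ?case by simp
  qed
  have "(\<lambda>n. survival y n (d ^ k)) \<longlonglongrightarrow> 0" using up[of "d ^ k - y"] yk by simp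
  then have "L * g (d ^ k) \<le> 0" using below by (intro LIMSEQ_le_const) auto
  moreover have "0 < g (d ^ k)" using reach_pos by (simp add: g_def)
  ultimately show False using L_pos by (simp add: mult_le_0_iff)
qed

section \<open>Infinite mean return time\<close>

text \<open>Counting measure on \<open>{..<d ^ K}\<close> is almost invariant, by \<open>sum_trans_op\<close>. Testing it against
  the expected hitting time of \<open>y\<close> would bound \<open>d ^ K\<close> independently of \<open>K\<close>.\<close>

lemma survival_not_summable:
  assumes lim: "reach \<longlonglongrightarrow> 0" and inf: "infinite {j. j \<ge> 1 \<and> p j < 1}"
  shows "\<not> summable (\<lambda>n. survival y n y)"
proof
  assume sum_y: "summable (\<lambda>n. survival y n y)"
  have propagate: "summable (\<lambda>n. survival y n z)"
    if "summable (\<lambda>n. survival y n x)" "z \<noteq> y" "z \<le> Suc x" "0 < amfc d p x z" for x z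
  proof -
    have "summable (\<lambda>n. amfc d p x z * survival y n z)"
    proof (rule summable_comparison_test_ev)
      show "summable (\<lambda>n. survival y (Suc n) x)" using that(1) by (subst summable_Suc_iff)
      show "\<forall>\<^sub>F n in sequentially. norm (amfc d p x z * survival y n z) \<le> survival y (Suc n) x"
        using amfc_mult_survival_le[OF that(2,3)] that(4) survival_bounds
        by (intro always_eventually allI) (simp add: abs_mult del: avoid.simps)
    qed
    then show ?thesis using that(4) by (simp add: summable_cmult_iff)
  qed
  have up: "summable (\<lambda>n. survival y n (y + i))" for i
  proof (induction i)
    case (Suc i)
    then show ?case using propagate[of "y + i" "y + Suc i"] amfc_Suc_pos[of "y + i"] by simp
  qed (use sum_y in simp)
  \<comment> \<open>The mean hitting time of \<open>y\<close> from 0 is finite: climb from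
    \<open>y\<close> to \<open>d ^ Suc k - 1\<close>, where a failure of counter
    \<open>j = k + 2\<close> leads to 0. It has positive chance since \<open>p j < 1\<close>, and
    such \<open>j\<close> are arbitrarily large.\<close>
  have "\<exists>C. \<forall>n. (if 0 = y then 0 else \<Sum>i<n. survival y i 0) \<le> C"
  proof (cases "0 = y")
    case False
    obtain j where j: "y + 2 \<le> j" "p j < 1"
    proof -
      have "\<not> {j. j \<ge> 1 \<and> p j < 1} \<subseteq> {..<y + 2}" using inf finite_subset by blast
      then obtain j where "p j < 1" "\<not> j < y + 2" by blast
      then show ?thesis using that by (simp add: not_less)
    qed
    then obtain k where k: "j = Suc (Suc k)" "y \<le> k" by (metis add_2_eq_Suc' le_Suc_ex add_Suc le_add1)
    let ?x = "d ^ Suc k - 1"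
    have "y \<le> ?x" using d_power_less[of k] k by simp
    then have "summable (\<lambda>n. survival y n ?x)" using up[of "?x - y"] by (simp only: le_add_diff_inverse)
    moreover have "0 < amfc d p ?x 0"
    proof -
      have "fail (Suc k) = reach (Suc k) * (1 - p j)" by (simp add: k algebra_simps)
      then have "0 < fail (Suc k)"
        using reach_pos[of "Suc k"] j by (simp del: prod.cl_ivl_Suc)
      moreover have "0 = Suc ?x - d ^ Suc k" using d by simp
      ultimately have "0 < of_bool (0 = Suc ?x - d ^ Suc k) * fail (Suc k)"
        by (simp only: simp_thms of_bool_eq mult_1)
      also have "\<dots> \<le> (\<Sum>r<zeta d ?x. of_bool (0 = Suc ?x - d ^ r) * fail r)"
        by (rule member_le_sum) (auto simp only: zeta_power lessThan_iff intro!: mult_nonneg_nonneg fail_nonneg, simp_all)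
      also have "\<dots> = amfc d p ?x 0" unfolding amfc_eq by simp
      finally show ?thesis .
    qed
    ultimately have "summable (\<lambda>n. survival y n 0)" by (rule propagate[OF _ False le0])
    then have "(\<Sum>i<n. survival y i 0) \<le> (\<Sum>i. survival y i 0)" for n
      using survival_bounds by (intro sum_le_suminf) auto
    then show ?thesis using False by auto
  qed auto
  then obtain C where C: "\<And>n. (if 0 = y then 0 else \<Sum>i<n. survival y i 0) \<le> C" by blast
  \<comment> \<open>\<open>w n x\<close> is the mean of the return time truncated at
    \<open>n\<close>.\<close>
  define w where "w n x = (\<Sum>i<n. survival y i x)" for n x
  define h where "h n = (w n)(y := 0)" for n
  have h0: "h n 0 \<le> C" for n using C[of n] by (auto simp: h_def w_def)
  have w_nonneg: "0 \<le> w n x" for n x unfolding w_def using survival_bounds by (intro sum_nonneg) blast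
  have h_nonneg: "0 \<le> h n x" for n x using w_nonneg by (simp add: h_def)
  have w_Suc: "w (Suc n) x = 1 + trans_op (h n) x" for n x
  proof -
    have "trans_op (h n) x = trans_op (\<lambda>z. \<Sum>i<n. ((survival y i)(y := 0)) z) x"
      by (intro sum.cong refl) (simp add: h_def w_def)
    also have "\<dots> = (\<Sum>i<n. trans_op ((survival y i)(y := 0)) x)"
      unfolding sum_distrib_left by (rule sum.swap)
    also have "\<dots> = (\<Sum>i<n. survival y (Suc i) x)" unfolding survival_Suc ..
    finally show ?thesis unfolding w_def by (subst sum.lessThan_Suc_shift) simp
  qed
  \<comment> \<open>Sum \<open>w_Suc\<close> over \<open>{..<d ^ K}\<close>. The sums of
    \<open>h n\<close> cancel, and the boundary term is at least \<open>- C\<close>.\<close>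
  have bound: "real (d ^ K) - C \<le> w n y + (\<Sum>x<d ^ K. survival y n x)" if "y < d ^ K" for K n
  proof -
    have "(\<Sum>x<d ^ K. w (Suc n) x) = d ^ K + ((\<Sum>x<d ^ K. h n x) + reach (Suc K) * (h n (d ^ K) - h n 0))"
      unfolding w_Suc sum.distrib sum_trans_op by simp
    moreover have "(\<Sum>x<d ^ K. w (Suc n) x) = (\<Sum>x<d ^ K. h n x) + w n y + (\<Sum>x<d ^ K. survival y n x)"
    proof -
      have "w (Suc n) x = h n x + (if x = y then w n y else 0) + survival y n x" for x
        by (simp add: h_def w_def)
      then show ?thesis using that by (simp add: sum.distrib)
    qed
    moreover have "- C \<le> reach (Suc K) * (h n (d ^ K) - h n 0)"
    proof -
      have "reach (Suc K) * h n 0 \<le> h n 0"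
        using antimonoD[OF reach_antimono, of 0 "Suc K"] reach_pos[of "Suc K"] h_nonneg[of n 0]
        by (intro mult_left_le_one_le) auto
      moreover have "0 \<le> reach (Suc K) * h n (d ^ K)"
        by (intro mult_nonneg_nonneg h_nonneg less_imp_le[OF reach_pos])
      ultimately show ?thesis using h0[of n] by (simp only: right_diff_distrib)
    qed
    ultimately show ?thesis by linarith
  qed
  let ?W = "\<Sum>n. survival y n y"
  \<comment> \<open>By recurrence the finite sum of survival probabilities vanishes as
    \<open>n\<close> grows, leaving a bound on \<open>d ^ K\<close> uniform in
    \<open>K\<close>.\<close>
  have final: "real (d ^ K) - C \<le> ?W" if "y < d ^ K" for K
  proof (rule LIMSEQ_le_const)
    have "(\<lambda>n. w n y + (\<Sum>x<d ^ K. survival y n x)) \<longlonglongrightarrow> ?W + (\<Sum>x<d ^ K. 0)"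
      unfolding w_def
      by (intro tendsto_add tendsto_sum survival_tendsto_0 lim summable_LIMSEQ sum_y)
    then show "(\<lambda>n. w n y + (\<Sum>x<d ^ K. survival y n x)) \<longlonglongrightarrow> ?W" by simp
  qed (use bound[OF that] in auto)
  obtain N where N: "?W + C < real N" using reals_Archimedean2 by blast
  have "Suc (N + y) < d ^ Suc (N + y)" by (rule d_power_less)
  moreover from this have "y < d ^ Suc (N + y)" by linarith
  note final[OF this]
  ultimately show False using N by linarith
qed

end

theorem proposition2p2:
  fixes d :: nat and p :: "nat \<Rightarrow> real"
    and P :: "nat \<Rightarrow> 'a measure" and X :: "nat \<Rightarrow> 'a \<Rightarrow> nat"
  assumes "d \<ge> 2"
    and "\<And>j. j \<ge> 1 \<Longrightarrow> 0 < p j \<and> p j \<le> 1"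
    and "infinite {j. j \<ge> 1 \<and> p j < 1}"
    and "markov_family (amfc d p) P X"
  shows "(null_recurrent P X \<longleftrightarrow> (\<lambda>n. \<Prod>j=1..n. p j) \<longlonglongrightarrow> 0) \<and>
         (\<not> (\<lambda>n. \<Prod>j=1..n. p j) \<longlonglongrightarrow> 0 \<longrightarrow> transient P X)"
proof -
  interpret fallible_counter d p using assms(1,2) by unfold_locales
  interpret finite_row_chain "amfc d p" P X "\<lambda>x. {..Suc x}"
  proof
    show "(\<Sum>z\<le>Suc x. amfc d p x z) = 1" for x
      using trans_op_const[of x 1] by (simp only: mult_1_right)
  qed (use assms(4) in simp_all)
  have null: "null_recurrent_state P X y" if lim: "reach \<longlonglongrightarrow> 0" for y
  proof -
    have "1 - \<P>(\<omega> in P y. return_time X y \<omega> < \<infinity>) = 0"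
      using avoid_tendsto survival_tendsto_0[OF lim] by (rule LIMSEQ_unique)
    moreover have "(\<integral>\<^sup>+\<omega>. ennreal_of_enat (return_time X y \<omega>) \<partial>P y) = \<infinity>"
    proof (rule ccontr)
      assume "\<not> ?thesis"
      then have "summable (\<lambda>n. survival y n y)"
        unfolding nn_integral_return_time infinity_ennreal_def
        by (rule summable_suminf_not_top[OF avoid_bounds(1)])
      then show False using survival_not_summable[OF lim assms(3)] by contradiction
    qed
    ultimately show ?thesis by (simp add: null_recurrent_state_def recurrent_state_def)
  qed
  have trans: "transient_state P X y" if lim: "\<not> reach \<longlonglongrightarrow> 0" for y
  proof -
    interpret prob_space "P y" by (rule prob_space_chain)
    have "\<P>(\<omega> in P y. return_time X y \<omega> < \<infinity>) \<noteq> 1"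
      using avoid_tendsto[of y y] survival_not_tendsto_0[OF lim, of y] by auto
    then show ?thesis
      unfolding transient_state_def using prob_le_1 by (simp add: less_le)
  qed
  \<comment> \<open>Recurrence and transience exclude each other already at 0, which gives the
    converse implication.\<close>
  have "\<not> (null_recurrent_state P X 0 \<and> transient_state P X 0)"
    by (simp add: null_recurrent_state_def recurrent_state_def transient_state_def)
  with null trans show ?thesis unfolding null_recurrent_def transient_def by blast
qed

end
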